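(* Let $k$ be a field of characteristic zero, let $B = k[t]$, and let $f = f_1 \cdots f_r$ with $r \ge 2$, where $f_1, \ldots, f_r \in k[t]$ are irreducible and pairwise coprime polynomials. Let $I = f\,k[t]$, let $A = k + I \subseteq k[t]$, and let $\mathscr{D}_A$ be the ring of $k$-linear differential operators on $A$. Then there is no bialgebroid structure (over $A$) on $\mathscr{D}_A$ for which the map $\varepsilon \colon \mathscr{D}_A \to A$, $D \mapsto D(1)$, is the counit.
   Context: The ring of $k$-linear differential operators (in the sense of Grothendieck) of a commutative $k$-algebra $A$ is the subalgebra $\mathscr{D}_A = \bigcup_{n \ge 0} \mathscr{D}_A^{n} \subseteq \operatorname{End}_k(A)$, where $\mathscr{D}_A^{-1} = 0$ and, for $n \ge 0$, $\mathscr{D}_A^{n} = \{ D \in \operatorname{End}_k(A) : [D, a] \in \mathscr{D}_A^{n-1} \text{ for all } a \in A \}$; here $a \in A$ is identified with the multiplication operator $b \mapsto ab$, so $A \subseteq \mathscr{D}_A$. For $D \in \mathscr{D}_A$ and $a \in A$, $D(a) \in A$ denotes the value of $D$ at $a$, while $Da$ and $aD$ denote products in the ring $\mathscr{D}_A$. The tensor product $\mathscr{D}_A \otimes_A \mathscr{D}_A$ is formed using the left $A$-module structure of $\mathscr{D}_A$ on both factors, so $aD_1 \otimes_A D_2 = D_1 \otimes_A aD_2$. A bialgebroid structure over $A$ on $\mathscr{D}_A$ (with source and target maps both equal to the inclusion $A \subseteq \mathscr{D}_A$) consists of left $A$-linear maps $\Delta \colon \mathscr{D}_A \to \mathscr{D}_A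 \otimes_A \mathscr{D}_A$ (comultiplication) and $\varepsilon \colon \mathscr{D}_A \to A$ (counit) such that: (i) $\Delta$ is coassociative and $\varepsilon$ is a counit for it: $(\Delta \otimes_A \mathrm{id})\Delta = (\mathrm{id} \otimes_A \Delta)\Delta$ and $(\varepsilon \otimes_A \mathrm{id})\Delta = \mathrm{id} = (\mathrm{id} \otimes_A \varepsilon)\Delta$ (under $A \otimes_A \mathscr{D}_A \cong \mathscr{D}_A \cong \mathscr{D}_A \otimes_A A$); (ii) the image of $\Delta$ lies in the Takeuchi product $\mathscr{D}_A \times_A \mathscr{D}_A = \{ \sum_i D_i \otimes_A E_i : \sum_i D_i a \otimes_A E_i = \sum_i D_i \otimes_A E_i a \text{ for all } a \in A \}$, which is a ring under factorwise multiplication, and $\Delta \colon \mathscr{D}_A \to \mathscr{D}_A \times_A \mathscr{D}_A$ is a unital ring homomorphism; (iii) $\varepsilon(1) = 1$ and $\varepsilon(DE) = \varepsilon(D\,\varepsilon(E))$ for all $D, E \in \mathscr{D}_A$. *)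

theory Defs
  imports
    "HOL-Algebra.Module"
    "HOL-Algebra.QuotRing"
    "HOL-Algebra.Free_Abelian_Groups"
    "HOL-Algebra.Algebraic_Closure_Type"
    "HOL-Computational_Algebra.Polynomial"
begin

section \<open>Modules and tensor products\<close>

definition lin_hom ::
    "('r, 's) ring_scheme \<Rightarrow> ('r, 'm, 'x) module_scheme \<Rightarrow> ('r, 'n, 'y) module_scheme \<Rightarrow> ('m \<Rightarrow> 'n) set"
  where "lin_hom R M N = {h \<in> carrier M \<rightarrow> carrier N.
     (\<forall>x\<in>carrier M. \<forall>y\<in>carrier M. h (x \<oplus>\<^bsub>M\<^esub> y) = h x \<oplus>\<^bsub>N\<^esub> h y) \<and>
     (\<forall>r\<in>carrier R. \<forall>x\<in>carrier M. h (r \<odot>\<^bsub>M\<^esub> x) = r \<odot>\<^bsub>N\<^esub> h x)}"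

definition regular_module :: "('r, 's) ring_scheme \<Rightarrow> ('r, 'r) module"
  where "regular_module R =
    \<lparr>carrier = carrier R, monoid.mult = monoid.mult R, one = \<one>\<^bsub>R\<^esub>,
     zero = \<zero>\<^bsub>R\<^esub>, add = add R, module.smult = monoid.mult R\<rparr>"

text \<open>
  The tensor product is the free abelian group on pairs modulo the subgroup generated by the
  bilinearity and balancing relations. Its elements are cosets of finitely supported functions
  from pairs to the integers; pointwise addition and subtraction are the operations of
  the free abelian group.
\<close>

definition tensor_rel ::
    "('r, 's) ring_scheme \<Rightarrow> ('r, 'm, 'x) module_scheme \<Rightarrow> ('r, 'n, 'y) module_scheme
      \<Rightarrow> ('m \<times> 'n \<Rightarrow>\<^sub>0 int) set"
  where "tensor_rel R M N = generate (free_Abelian_group (carrier M \<times> carrier N))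
    ({frag_of (x \<oplus>\<^bsub>M\<^esub> x', y) - (frag_of (x, y) + frag_of (x', y)) | x x' y.
        x \<in> carrier M \<and> x' \<in> carrier M \<and> y \<in> carrier N} \<union>
     {frag_of (x, y \<oplus>\<^bsub>N\<^esub> y') - (frag_of (x, y) + frag_of (x, y')) | x y y'.
        x \<in> carrier M \<and> y \<in> carrier N \<and> y' \<in> carrier N} \<union>
     {frag_of (r \<odot>\<^bsub>M\<^esub> x, y) - frag_of (x, r \<odot>\<^bsub>N\<^esub> y) | r x y.
        r \<in> carrier R \<and> x \<in> carrier M \<and> y \<in> carrier N})"

definition tensor_group ::
    "('r, 's) ring_scheme \<Rightarrow> ('r, 'm, 'x) module_scheme \<Rightarrow> ('r, 'n, 'y) module_scheme
      \<Rightarrow> ('m \<times> 'n \<Rightarrow>\<^sub>0 int) set monoid"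
  where "tensor_group R M N =
    free_Abelian_group (carrier M \<times> carrier N) Mod tensor_rel R M N"

definition pure_tensor ::
    "('r, 's) ring_scheme \<Rightarrow> ('r, 'm, 'x) module_scheme \<Rightarrow> ('r, 'n, 'y) module_scheme
      \<Rightarrow> 'm \<Rightarrow> 'n \<Rightarrow> ('m \<times> 'n \<Rightarrow>\<^sub>0 int) set"
  where "pure_tensor R M N x y =
    tensor_rel R M N #>\<^bsub>free_Abelian_group (carrier M \<times> carrier N)\<^esub> frag_of (x, y)"

text \<open>
  The additive map induced by a balanced biadditive map \<open>\<beta>\<close> into the abelian group \<open>P\<close>: it sends
  the class of a formal sum of pairs \<open>(x, y)\<close> to the corresponding sum of the \<open>\<beta> x y\<close>. For such \<open>\<beta>\<close>
  the set of values over all representatives \<open>u\<close> of the class \<open>U\<close> is a singleton; for other \<open>\<beta>\<close> the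
  value is of no significance.
\<close>

definition tensor_lift ::
    "('p, 'z) ring_scheme \<Rightarrow> ('m \<Rightarrow> 'n \<Rightarrow> 'p) \<Rightarrow> ('m \<times> 'n \<Rightarrow>\<^sub>0 int) set \<Rightarrow> 'p"
  where "tensor_lift P \<beta> U = the_elem
    ((\<lambda>u. \<Oplus>\<^bsub>P\<^esub>p\<in>Poly_Mapping.keys u.
        [Poly_Mapping.lookup u p] \<cdot>\<^bsub>P\<^esub> \<beta> (fst p) (snd p)) ` U)"

text \<open>
  A module record is a ring record with a scalar multiplication; a tensor product of modules
  has no product of its own, so the ring multiplication and unit are left unspecified.
\<close>

definition tensor_add_group ::
    "('r, 's) ring_scheme \<Rightarrow> ('r, 'm, 'x) module_scheme \<Rightarrow> ('r, 'n, 'y) module_scheme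
      \<Rightarrow> ('m \<times> 'n \<Rightarrow>\<^sub>0 int) set ring"
  where "tensor_add_group R M N =
    \<lparr>carrier = carrier (tensor_group R M N), monoid.mult = undefined, one = undefined,
     zero = \<one>\<^bsub>tensor_group R M N\<^esub>, add = monoid.mult (tensor_group R M N)\<rparr>"

definition tensor ::
    "('r, 's) ring_scheme \<Rightarrow> ('r, 'm, 'x) module_scheme \<Rightarrow> ('r, 'n, 'y) module_scheme
      \<Rightarrow> ('r, ('m \<times> 'n \<Rightarrow>\<^sub>0 int) set) module"
  where "tensor R M N = ring.extend (tensor_add_group R M N)
    \<lparr>module.smult = (\<lambda>r. tensor_lift (tensor_add_group R M N)
       (\<lambda>x y. pure_tensor R M N (r \<odot>\<^bsub>M\<^esub> x) y))\<rparr>"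

text \<open>\<open>tensor_map R M' N' f g\<close> is \<open>f \<otimes> g\<close>, as a map into \<open>M' \<otimes> N'\<close>.\<close>

definition tensor_map ::
    "('r, 's) ring_scheme \<Rightarrow> ('r, 'm1, 'x) module_scheme \<Rightarrow> ('r, 'n1, 'y) module_scheme
      \<Rightarrow> ('m \<Rightarrow> 'm1) \<Rightarrow> ('n \<Rightarrow> 'n1) \<Rightarrow> ('m \<times> 'n \<Rightarrow>\<^sub>0 int) set \<Rightarrow> ('m1 \<times> 'n1 \<Rightarrow>\<^sub>0 int) set"
  where "tensor_map R M' N' f g =
    tensor_lift (tensor R M' N') (\<lambda>x y. pure_tensor R M' N' (f x) (g y))"

text \<open>The canonical map \<open>(L \<otimes> M) \<otimes> N \<rightarrow> L \<otimes> (M \<otimes> N)\<close>.\<close>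

definition tensor_assoc ::
    "('r, 's) ring_scheme \<Rightarrow> ('r, 'l, 'w) module_scheme \<Rightarrow> ('r, 'm, 'x) module_scheme
      \<Rightarrow> ('r, 'n, 'y) module_scheme
      \<Rightarrow> (('l \<times> 'm \<Rightarrow>\<^sub>0 int) set \<times> 'n \<Rightarrow>\<^sub>0 int) set
      \<Rightarrow> ('l \<times> ('m \<times> 'n \<Rightarrow>\<^sub>0 int) set \<Rightarrow>\<^sub>0 int) set"
  where "tensor_assoc R L M N =
    tensor_lift (tensor R L (tensor R M N)) (\<lambda>u z.
      tensor_lift (tensor R L (tensor R M N)) (\<lambda>x y.
        pure_tensor R L (tensor R M N) x (pure_tensor R M N y z)) u)"

section \<open>Bialgebroids with equal source and target\<close>

text \<open>
  Here \<open>H\<close> is a ring which is also a left \<open>A\<close>-module with \<open>a \<odot> D = (a \<odot> 1) D\<close>; the map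
  \<open>a \<mapsto> a \<odot> 1\<close> is the common source and target map.
\<close>

definition base_incl :: "('a, 'h, 'x) module_scheme \<Rightarrow> 'a \<Rightarrow> 'h"
  where "base_incl H a = a \<odot>\<^bsub>H\<^esub> \<one>\<^bsub>H\<^esub>"

text \<open>
  The product of the classes \<open>U\<close> and \<open>V\<close> is factorwise. It is well defined as soon as \<open>U\<close> lies in
  the Takeuchi product: the inner lift is balanced for all \<open>D'\<close>, \<open>E'\<close>, and the Takeuchi condition
  on \<open>U\<close> is what makes the outer one balanced.
\<close>

definition takeuchi ::
    "('a, 's) ring_scheme \<Rightarrow> ('a, 'h, 'x) module_scheme \<Rightarrow> ('h \<times> 'h \<Rightarrow>\<^sub>0 int) set ring"
  where "takeuchi A H =
    \<lparr>carrier = {U \<in> carrier (tensor A H H). \<forall>a\<in>carrier A.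
        tensor_map A H H (\<lambda>D. D \<otimes>\<^bsub>H\<^esub> base_incl H a) (\<lambda>E. E) U =
        tensor_map A H H (\<lambda>D. D) (\<lambda>E. E \<otimes>\<^bsub>H\<^esub> base_incl H a) U},
     monoid.mult = (\<lambda>U V. tensor_lift (tensor A H H) (\<lambda>D' E'.
        tensor_lift (tensor A H H) (\<lambda>D E.
          pure_tensor A H H (D \<otimes>\<^bsub>H\<^esub> D') (E \<otimes>\<^bsub>H\<^esub> E')) U) V),
     one = pure_tensor A H H \<one>\<^bsub>H\<^esub> \<one>\<^bsub>H\<^esub>,
     zero = \<zero>\<^bsub>tensor A H H\<^esub>,
     add = add (tensor A H H)\<rparr>"

text \<open>
  In the counit axioms \<open>H\<close> is identified with \<open>A \<otimes> H\<close> and \<open>H \<otimes> A\<close> by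
  \<open>D \<mapsto> 1 \<otimes> D\<close> and \<open>D \<mapsto> D \<otimes> 1\<close>.
\<close>

definition bialgebroid_structure ::
    "('a, 's) ring_scheme \<Rightarrow> ('a, 'h, 'x) module_scheme
      \<Rightarrow> ('h \<Rightarrow> ('h \<times> 'h \<Rightarrow>\<^sub>0 int) set) \<Rightarrow> ('h \<Rightarrow> 'a) \<Rightarrow> bool"
  where "bialgebroid_structure A H \<Delta> \<epsilon> \<longleftrightarrow>
    \<Delta> \<in> lin_hom A H (tensor A H H) \<and>
    \<epsilon> \<in> lin_hom A H (regular_module A) \<and>
    (\<forall>D\<in>carrier H.
       tensor_assoc A H H H (tensor_map A (tensor A H H) H \<Delta> (\<lambda>E. E) (\<Delta> D)) =
       tensor_map A H (tensor A H H) (\<lambda>E. E) \<Delta> (\<Delta> D)) \<and>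
    (\<forall>D\<in>carrier H.
       tensor_map A (regular_module A) H \<epsilon> (\<lambda>E. E) (\<Delta> D) =
         pure_tensor A (regular_module A) H \<one>\<^bsub>A\<^esub> D) \<and>
    (\<forall>D\<in>carrier H.
       tensor_map A H (regular_module A) (\<lambda>E. E) \<epsilon> (\<Delta> D) =
         pure_tensor A H (regular_module A) D \<one>\<^bsub>A\<^esub>) \<and>
    \<Delta> \<in> ring_hom H (takeuchi A H) \<and>
    \<epsilon> \<one>\<^bsub>H\<^esub> = \<one>\<^bsub>A\<^esub> \<and>
    (\<forall>D\<in>carrier H. \<forall>E\<in>carrier H.
       \<epsilon> (D \<otimes>\<^bsub>H\<^esub> E) = \<epsilon> (D \<otimes>\<^bsub>H\<^esub> base_incl H (\<epsilon> E)))"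

section \<open>Differential operators\<close>

text \<open>
  Endomorphisms of a \<open>K\<close>-algebra \<open>A\<close> are represented as functions that are \<open>undefined\<close> outside
  \<open>carrier A\<close>, so that equality of functions is equality of endomorphisms.
\<close>

definition endos :: "('k, 's) ring_scheme \<Rightarrow> ('k, 'a, 'x) module_scheme \<Rightarrow> ('a \<Rightarrow> 'a) set"
  where "endos K A = lin_hom K A A \<inter> extensional (carrier A)"

definition commutator :: "('k, 'a, 'x) module_scheme \<Rightarrow> ('a \<Rightarrow> 'a) \<Rightarrow> 'a \<Rightarrow> ('a \<Rightarrow> 'a)"
  where "commutator A D a =
    (\<lambda>b\<in>carrier A. D (a \<otimes>\<^bsub>A\<^esub> b) \<ominus>\<^bsub>A\<^esub> a \<otimes>\<^bsub>A\<^esub> D b)"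

text \<open>The index is shifted by one: \<open>diff_op_filt K A n\<close> consists of the operators of order
  at most \<open>n - 1\<close>, and only the zero operator has order at most \<open>-1\<close>.\<close>

primrec diff_op_filt ::
    "('k, 's) ring_scheme \<Rightarrow> ('k, 'a, 'x) module_scheme \<Rightarrow> nat \<Rightarrow> ('a \<Rightarrow> 'a) set"
  where
    "diff_op_filt K A 0 = {\<lambda>b\<in>carrier A. \<zero>\<^bsub>A\<^esub>}"
  | "diff_op_filt K A (Suc n) =
      {D \<in> endos K A. \<forall>a\<in>carrier A. commutator A D a \<in> diff_op_filt K A n}"

definition diff_ops ::
    "('k, 's) ring_scheme \<Rightarrow> ('k, 'a, 'x) module_scheme \<Rightarrow> ('a, 'a \<Rightarrow> 'a) module"
  where "diff_ops K A =
    \<lparr>carrier = (\<Union>n. diff_op_filt K A (Suc n)),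
     monoid.mult = (\<lambda>D E. \<lambda>b\<in>carrier A. D (E b)),
     one = (\<lambda>b\<in>carrier A. b),
     zero = (\<lambda>b\<in>carrier A. \<zero>\<^bsub>A\<^esub>),
     add = (\<lambda>D E. \<lambda>b\<in>carrier A. D b \<oplus>\<^bsub>A\<^esub> E b),
     module.smult = (\<lambda>a D. \<lambda>b\<in>carrier A. a \<otimes>\<^bsub>A\<^esub> D b)\<rparr>"

section \<open>The subalgebra \<open>k + f k[t]\<close> of \<open>k[t]\<close>\<close>

definition const_plus_ideal :: "'k::field poly \<Rightarrow> ('k, 'k poly) module"
  where "const_plus_ideal f =
    \<lparr>carrier = {[:c:] + f * g | c g. True}, monoid.mult = (*), one = 1,
     zero = 0, add = (+), module.smult = Polynomial.smult\<rparr>"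

end

theory Submission
  imports Defs "HOL-Computational_Algebra.Polynomial_Factorial"
begin

text \<open>
  Every \<open>D \<in> \<D>\<close> maps \<open>I = f k[t]\<close> into itself: \<open>D f\<close> is a differential operator \<open>k[t] \<rightarrow> A\<close>, so its
  value modulo \<open>f\<close> is a constant which vanishes on high powers of each \<open>f\<^sub>i\<close>, and two of the \<open>f\<^sub>i\<close> are
  coprime. On the other hand, in a bialgebroid with counit \<open>D \<mapsto> D(1)\<close> one has
  \<open>D(a b) = \<Sum>\<^sub>i D\<^sub>i(a) E\<^sub>i(b)\<close> if \<open>\<Delta> D = \<Sum>\<^sub>i D\<^sub>i \<otimes> E\<^sub>i\<close>. With \<open>a = b = f\<close> this gives \<open>D(f\<^sup>2) \<in> f\<^sup>2 k[t]\<close> for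
  all \<open>D \<in> \<D>\<close>, which fails for \<open>D = f \<partial>\<^sup>2\<close> because \<open>f\<close> is squarefree.
\<close>

section \<open>Tensor products\<close>

text \<open>Besides closure, one law for each family of generators of \<open>tensor_rel\<close>.
  \<open>P\<close> enters only as an additive group, so scalars move across the pair instead of out
  of it.\<close>

definition balanced ::
    "('r, 's) ring_scheme \<Rightarrow> ('r, 'm, 'x) module_scheme \<Rightarrow> ('r, 'n, 'y) module_scheme
      \<Rightarrow> ('p, 'z) ring_scheme \<Rightarrow> ('m \<Rightarrow> 'n \<Rightarrow> 'p) \<Rightarrow> bool"
  where "balanced R M N P \<beta> \<longleftrightarrow>
    (\<forall>x\<in>carrier M. \<forall>y\<in>carrier N. \<beta> x y \<in> carrier P) \<and>
    (\<forall>x\<in>carrier M. \<forall>x'\<in>carrier M. \<forall>y\<in>carrier N. \<beta> (x \<oplus>\<^bsub>M\<^esub> x') y = \<beta> x y \<oplus>\<^bsub>P\<^esub> \<beta> x' y) \<and>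
    (\<forall>x\<in>carrier M. \<forall>y\<in>carrier N. \<forall>y'\<in>carrier N. \<beta> x (y \<oplus>\<^bsub>N\<^esub> y') = \<beta> x y \<oplus>\<^bsub>P\<^esub> \<beta> x y') \<and>
    (\<forall>r\<in>carrier R. \<forall>x\<in>carrier M. \<forall>y\<in>carrier N. \<beta> (r \<odot>\<^bsub>M\<^esub> x) y = \<beta> x (r \<odot>\<^bsub>N\<^esub> y))"

lemma carrier_tensor [simp]: "carrier (tensor R M N) = carrier (tensor_group R M N)"
  by (simp add: tensor_def tensor_add_group_def ring.defs)

lemma add_tensor [simp]: "add (tensor R M N) = monoid.mult (tensor_group R M N)"
  by (simp add: tensor_def tensor_add_group_def ring.defs)

lemma zero_tensor [simp]: "\<zero>\<^bsub>tensor R M N\<^esub> = \<one>\<^bsub>tensor_group R M N\<^esub>"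
  by (simp add: tensor_def tensor_add_group_def ring.defs)

lemma hom_add_monoid_tensor [simp]: "hom G (add_monoid (tensor R M N)) = hom G (tensor_group R M N)"
  by (simp add: hom_def)

text \<open>These closures keep the relators inside the free abelian group on pairs of carrier
  elements, so that the quotient by them is an abelian group.\<close>

locale module_pair =
  fixes R :: "('r, 's) ring_scheme" and M :: "('r, 'm, 'x) module_scheme"
    and N :: "('r, 'n, 'y) module_scheme"
  assumes add_closed_left: "\<lbrakk>x \<in> carrier M; x' \<in> carrier M\<rbrakk> \<Longrightarrow> x \<oplus>\<^bsub>M\<^esub> x' \<in> carrier M"
    and smult_closed_left: "\<lbrakk>r \<in> carrier R; x \<in> carrier M\<rbrakk> \<Longrightarrow> r \<odot>\<^bsub>M\<^esub> x \<in> carrier M"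
    and add_closed_right: "\<lbrakk>y \<in> carrier N; y' \<in> carrier N\<rbrakk> \<Longrightarrow> y \<oplus>\<^bsub>N\<^esub> y' \<in> carrier N"
    and smult_closed_right: "\<lbrakk>r \<in> carrier R; y \<in> carrier N\<rbrakk> \<Longrightarrow> r \<odot>\<^bsub>N\<^esub> y \<in> carrier N"
begin

abbreviation F where "F \<equiv> free_Abelian_group (carrier M \<times> carrier N)"

definition relators where "relators =
    {frag_of (x \<oplus>\<^bsub>M\<^esub> x', y) - (frag_of (x, y) + frag_of (x', y)) | x x' y.
        x \<in> carrier M \<and> x' \<in> carrier M \<and> y \<in> carrier N} \<union>
     {frag_of (x, y \<oplus>\<^bsub>N\<^esub> y') - (frag_of (x, y) + frag_of (x, y')) | x y y'.
        x \<in> carrier M \<and> y \<in> carrier N \<and> y' \<in> carrier N} \<union>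
     {frag_of (r \<odot>\<^bsub>M\<^esub> x, y) - frag_of (x, r \<odot>\<^bsub>N\<^esub> y) | r x y.
        r \<in> carrier R \<and> x \<in> carrier M \<and> y \<in> carrier N}"

lemma tensor_rel_eq: "tensor_rel R M N = generate F relators"
  by (simp add: tensor_rel_def relators_def)

lemma diff_in_F: "\<lbrakk>u \<in> carrier F; v \<in> carrier F\<rbrakk> \<Longrightarrow> u - v \<in> carrier F"
  using keys_diff[of u v] by auto

lemma add_in_F: "\<lbrakk>u \<in> carrier F; v \<in> carrier F\<rbrakk> \<Longrightarrow> u + v \<in> carrier F"
  using keys_add[of u v] by auto

lemma frag_in_F: "\<lbrakk>x \<in> carrier M; y \<in> carrier N\<rbrakk> \<Longrightarrow> frag_of (x, y) \<in> carrier F"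
  by simp

lemma relators_subset: "relators \<subseteq> carrier F"
  unfolding relators_def
  by (auto simp del: carrier_free_Abelian_group_iff intro!: diff_in_F add_in_F frag_in_F
      add_closed_left smult_closed_left add_closed_right smult_closed_right)

lemma subgroup_tensor_rel: "subgroup (tensor_rel R M N) F"
  unfolding tensor_rel_eq by (rule group.generate_is_subgroup[OF _ relators_subset]) simp

lemma normal_tensor_rel: "tensor_rel R M N \<lhd> F"
  using subgroup_tensor_rel comm_group.normal_iff_subgroup[OF abelian_free_Abelian_group] by blast

lemma comm_group_tensor: "comm_group (tensor_group R M N)"
  unfolding tensor_group_def
  by (rule comm_group.abelian_FactGroup[OF abelian_free_Abelian_group subgroup_tensor_rel])

lemma abelian_group_tensor: "abelian_group (tensor R M N)"
proof -
  interpret T: comm_group "tensor_group R M N" by (rule comm_group_tensor)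
  show ?thesis
    by (rule abelian_groupI) (simp_all add: T.m_ac T.l_inv_ex)
qed

lemma tensor_rel_coset_hom:
  "(\<lambda>u. tensor_rel R M N #>\<^bsub>F\<^esub> u) \<in> hom F (tensor_group R M N)"
  unfolding tensor_group_def by (rule normal.r_coset_hom_Mod[OF normal_tensor_rel])

lemma tensor_rel_coset_eqI:
  assumes "u \<in> carrier F" "v \<in> carrier F" "u - v \<in> relators"
  shows "tensor_rel R M N #>\<^bsub>F\<^esub> u = tensor_rel R M N #>\<^bsub>F\<^esub> v"
proof -
  have "u - v \<in> tensor_rel R M N"
    unfolding tensor_rel_eq by (rule generate.incl[OF assms(3)])
  then have "u \<in> tensor_rel R M N #>\<^bsub>F\<^esub> v"
    by (force simp: r_coset_def)
  then show ?thesis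
    by (metis group.repr_independence group_free_Abelian_group assms(2) subgroup_tensor_rel)
qed

lemma balanced_pure_tensor: "balanced R M N (tensor R M N) (pure_tensor R M N)"
proof -
  note [simp del] = carrier_free_Abelian_group_iff
  note clo = diff_in_F add_in_F frag_in_F
      add_closed_left smult_closed_left add_closed_right smult_closed_right
  note add = hom_mult[OF tensor_rel_coset_hom, unfolded mult_free_Abelian_group]
  show ?thesis
    unfolding balanced_def
  proof (intro conjI ballI)
    fix x y assume "x \<in> carrier M" "y \<in> carrier N"
    then show "pure_tensor R M N x y \<in> carrier (tensor R M N)"
      unfolding pure_tensor_def using hom_in_carrier[OF tensor_rel_coset_hom frag_in_F] by simp
  next
    fix x x' y assume *: "x \<in> carrier M" "x' \<in> carrier M" "y \<in> carrier N"
    then have "frag_of (x \<oplus>\<^bsub>M\<^esub> x', y) - (frag_of (x, y) + frag_of (x', y)) \<in> relators"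
      unfolding relators_def by blast
    then show "pure_tensor R M N (x \<oplus>\<^bsub>M\<^esub> x') y =
        pure_tensor R M N x y \<oplus>\<^bsub>tensor R M N\<^esub> pure_tensor R M N x' y"
      unfolding pure_tensor_def add_tensor using *
      by (simp add: add[symmetric] clo tensor_rel_coset_eqI)
  next
    fix x y y' assume *: "x \<in> carrier M" "y \<in> carrier N" "y' \<in> carrier N"
    then have "frag_of (x, y \<oplus>\<^bsub>N\<^esub> y') - (frag_of (x, y) + frag_of (x, y')) \<in> relators"
      unfolding relators_def by blast
    then show "pure_tensor R M N x (y \<oplus>\<^bsub>N\<^esub> y') =
        pure_tensor R M N x y \<oplus>\<^bsub>tensor R M N\<^esub> pure_tensor R M N x y'"
      unfolding pure_tensor_def add_tensor using *
      by (simp add: add[symmetric] clo tensor_rel_coset_eqI)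
  next
    fix r x y assume *: "r \<in> carrier R" "x \<in> carrier M" "y \<in> carrier N"
    then have "frag_of (r \<odot>\<^bsub>M\<^esub> x, y) - frag_of (x, r \<odot>\<^bsub>N\<^esub> y) \<in> relators"
      unfolding relators_def by blast
    then show "pure_tensor R M N (r \<odot>\<^bsub>M\<^esub> x) y = pure_tensor R M N x (r \<odot>\<^bsub>N\<^esub> y)"
      unfolding pure_tensor_def using *
      by (intro tensor_rel_coset_eqI) (simp_all add: clo)
  qed
qed

lemma pure_tensor_closed:
  "\<lbrakk>x \<in> carrier M; y \<in> carrier N\<rbrakk> \<Longrightarrow> pure_tensor R M N x y \<in> carrier (tensor_group R M N)"
  using balanced_pure_tensor by (simp add: balanced_def)

text \<open>Pure tensors are the images of the free generators, hence generate. An equaliser as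
  \<open>S\<close> gives uniqueness of homomorphisms, a divisibility condition gives
  \<open>tensor_lift_dvd\<close>.\<close>

lemma subgroup_pure_tensors_carrier:
  assumes S: "subgroup S (tensor_group R M N)"
    and pure: "\<And>x y. \<lbrakk>x \<in> carrier M; y \<in> carrier N\<rbrakk> \<Longrightarrow> pure_tensor R M N x y \<in> S"
  shows "carrier (tensor_group R M N) \<subseteq> S"
proof
  fix U assume "U \<in> carrier (tensor_group R M N)"
  then obtain u where u: "Poly_Mapping.keys u \<subseteq> carrier M \<times> carrier N"
    and U: "U = tensor_rel R M N #>\<^bsub>F\<^esub> u"
    unfolding tensor_group_def carrier_FactGroup by auto
  have T: "group (tensor_group R M N)"
    using comm_group_tensor by (simp add: comm_group_def)
  interpret \<pi>: group_hom F "tensor_group R M N" "\<lambda>u. tensor_rel R M N #>\<^bsub>F\<^esub> u"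
    by (rule group_hom.intro[OF group_free_Abelian_group T])
       (simp add: group_hom_axioms_def tensor_rel_coset_hom)
  from u have "tensor_rel R M N #>\<^bsub>F\<^esub> u \<in> S"
  proof (induction u rule: free_Abelian_group_induct[consumes 1])
    case 1
    then show ?case using \<pi>.hom_one subgroup.one_closed[OF S] by simp
  next
    \<comment> \<open>Closure under differences also accounts for negative coefficients; the
      difference is read as \<open>u + (- v)\<close>, where the coset map respects sums and
      inverses.\<close>
    case (2 u v)
    have "tensor_rel R M N #>\<^bsub>F\<^esub> (u - v) = (tensor_rel R M N #>\<^bsub>F\<^esub> u)
        \<otimes>\<^bsub>tensor_group R M N\<^esub> inv\<^bsub>tensor_group R M N\<^esub> (tensor_rel R M N #>\<^bsub>F\<^esub> v)"
      using \<pi>.hom_mult[of u "- v"] \<pi>.hom_inv[of v] 2(1,2) by simp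
    then show ?case
      using 2(3,4) subgroup.m_closed[OF S] subgroup.m_inv_closed[OF S] by simp
  next
    case (3 p)
    then show ?case
      using pure[of "fst p" "snd p"] by (auto simp: pure_tensor_def)
  qed
  then show "U \<in> S" by (simp add: U)
qed

lemma tensor_hom_eqI:
  assumes G: "group G" and \<phi>: "\<phi> \<in> hom (tensor_group R M N) G" and \<psi>: "\<psi> \<in> hom (tensor_group R M N) G"
    and pure: "\<And>x y. \<lbrakk>x \<in> carrier M; y \<in> carrier N\<rbrakk> \<Longrightarrow>
      \<phi> (pure_tensor R M N x y) = \<psi> (pure_tensor R M N x y)"
    and U: "U \<in> carrier (tensor_group R M N)"
  shows "\<phi> U = \<psi> U"
proof -
  have T: "group (tensor_group R M N)"
    using comm_group_tensor by (simp add: comm_group_def)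
  interpret \<phi>: group_hom "tensor_group R M N" G \<phi>
    by (rule group_hom.intro[OF T G]) (simp add: group_hom_axioms_def \<phi>)
  interpret \<psi>: group_hom "tensor_group R M N" G \<psi>
    by (rule group_hom.intro[OF T G]) (simp add: group_hom_axioms_def \<psi>)
  have "subgroup {V \<in> carrier (tensor_group R M N). \<phi> V = \<psi> V} (tensor_group R M N)"
    by (rule group.subgroupI[OF T]) (use \<phi>.hom_one \<psi>.hom_one in force)+
  from subgroup_pure_tensors_carrier[OF this] show ?thesis
    using U pure pure_tensor_closed by blast
qed

text \<open>The universal property: the additive extension of \<beta> to the free group kills all
  relators, so it is constant on cosets and \<open>the_elem\<close> is applied to a
  singleton.\<close>

lemma tensor_lift:
  assumes P: "abelian_group P" and \<beta>: "balanced R M N P \<beta>"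
  shows tensor_lift_hom: "tensor_lift P \<beta> \<in> hom (tensor_group R M N) (add_monoid P)"
    and tensor_lift_pure: "\<lbrakk>x \<in> carrier M; y \<in> carrier N\<rbrakk> \<Longrightarrow>
      tensor_lift P \<beta> (pure_tensor R M N x y) = \<beta> x y"
proof -
  interpret P: abelian_group P by (rule P)
  have \<beta>_closed: "\<beta> x y \<in> carrier P" if "x \<in> carrier M" "y \<in> carrier N" for x y
    using \<beta> that by (simp add: balanced_def)
  define h where "h u = (\<Oplus>\<^bsub>P\<^esub>p\<in>Poly_Mapping.keys u.
        [Poly_Mapping.lookup u p] \<cdot>\<^bsub>P\<^esub> \<beta> (fst p) (snd p))" for u :: "'m \<times> 'n \<Rightarrow>\<^sub>0 int"
  \<comment> \<open>Padding a support with zero coefficients lets \<open>u\<close>, \<open>v\<close>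
    and \<open>u + v\<close> be summed over one index set.\<close>
  have h_superset: "h u = (\<Oplus>\<^bsub>P\<^esub>p\<in>K. [Poly_Mapping.lookup u p] \<cdot>\<^bsub>P\<^esub> \<beta> (fst p) (snd p))"
    if "finite K" "Poly_Mapping.keys u \<subseteq> K" "K \<subseteq> carrier M \<times> carrier N" for u K
    unfolding h_def using that
    by (intro P.add.finprod_mono_neutral_cong_left)
       (auto simp: in_keys_iff add_pow_def intro!: P.add.int_pow_closed[unfolded add_pow_def] \<beta>_closed)
  have h_add: "h (u + v) = h u \<oplus>\<^bsub>P\<^esub> h v" if "u \<in> carrier F" "v \<in> carrier F" for u v
  proof -
    let ?K = "Poly_Mapping.keys u \<union> Poly_Mapping.keys v"
    have K: "finite ?K" "?K \<subseteq> carrier M \<times> carrier N" using that by auto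
    have "h (u + v) = (\<Oplus>\<^bsub>P\<^esub>p\<in>?K. [Poly_Mapping.lookup u p] \<cdot>\<^bsub>P\<^esub> \<beta> (fst p) (snd p)
        \<oplus>\<^bsub>P\<^esub> [Poly_Mapping.lookup v p] \<cdot>\<^bsub>P\<^esub> \<beta> (fst p) (snd p))"
      using K keys_add[of u v]
      by (subst h_superset[of ?K]; (intro P.add.finprod_cong')?)
         (auto simp: lookup_add intro!: P.add.int_pow_mult P.add.m_closed P.add.int_pow_closed \<beta>_closed)
    also have "\<dots> = h u \<oplus>\<^bsub>P\<^esub> h v"
      using K by (subst P.add.finprod_multf)
        (auto intro!: P.add.int_pow_closed \<beta>_closed simp: h_superset[of ?K])
    finally show ?thesis .
  qed
  have h_closed: "h u \<in> carrier P" if "u \<in> carrier F" for u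
    unfolding h_def using that
    by (intro P.add.finprod_closed) (auto intro!: P.add.int_pow_closed \<beta>_closed)
  have h_hom: "h \<in> hom F (add_monoid P)"
    using h_closed h_add by (simp add: hom_def Pi_def)
  interpret h: group_hom F "add_monoid P" h
    by (rule group_hom.intro[OF group_free_Abelian_group P.a_group])
       (simp add: group_hom_axioms_def h_hom)
  have h_frag: "h (frag_of (x, y)) = \<beta> x y" if "x \<in> carrier M" "y \<in> carrier N" for x y
    using \<beta>_closed[OF that] unfolding h_def by (simp add: P.add.finprod_singleton_swap)
  \<comment> \<open>Relators are differences, so killing one amounts to equal values on its two
    terms, which is the matching law of \<open>balanced\<close>.\<close>
  have h_diff0: "h (u - v) = \<zero>\<^bsub>P\<^esub>" if uv: "u \<in> carrier F" "v \<in> carrier F" "h u = h v" for u v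
  proof -
    have "h u = h (u - v) \<oplus>\<^bsub>P\<^esub> h v"
      using h_add[of "u - v" v] diff_in_F[OF uv(1,2)] uv by simp
    then show ?thesis
      using uv h_closed diff_in_F[OF uv(1,2)] by (metis P.add.l_cancel_one P.a_comm)
  qed
  note clo = diff_in_F add_in_F frag_in_F
      add_closed_left smult_closed_left add_closed_right smult_closed_right
  have "relators \<subseteq> kernel F (add_monoid P) h"
    using \<beta> relators_subset unfolding relators_def kernel_def
    by (auto simp: balanced_def h_frag h_add clo simp del: carrier_free_Abelian_group_iff intro!: h_diff0)
  then have ker: "tensor_rel R M N \<subseteq> kernel F (add_monoid P) h"
    unfolding tensor_rel_eq
    by (rule group.generate_subgroup_incl[OF group_free_Abelian_group _ h.subgroup_kernel])
  have coset: "tensor_lift P \<beta> (tensor_rel R M N #>\<^bsub>F\<^esub> u) = h u" if u: "u \<in> carrier F" for u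
  proof -
    have "h ` (tensor_rel R M N #>\<^bsub>F\<^esub> u) = {h u}"
    proof -
      have "tensor_rel R M N #>\<^bsub>F\<^esub> u = (\<lambda>w. w + u) ` tensor_rel R M N"
        by (auto simp: r_coset_def)
      moreover have "h (w + u) = h u" if "w \<in> tensor_rel R M N" for w
        using ker that u h_add[of w u] h_closed[OF u] by (auto simp: kernel_def)
      moreover have "tensor_rel R M N \<noteq> {}"
        using subgroup.one_closed[OF subgroup_tensor_rel] by blast
      ultimately show ?thesis
        by (auto simp: image_image)
    qed
    then show ?thesis
      unfolding tensor_lift_def h_def[symmetric] by simp
  qed
  show "tensor_lift P \<beta> (pure_tensor R M N x y) = \<beta> x y" if "x \<in> carrier M" "y \<in> carrier N"
    unfolding pure_tensor_def using that by (simp add: coset h_frag)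
  show "tensor_lift P \<beta> \<in> hom (tensor_group R M N) (add_monoid P)"
  proof (rule homI)
    fix U assume "U \<in> carrier (tensor_group R M N)"
    then show "tensor_lift P \<beta> U \<in> carrier (add_monoid P)"
      unfolding tensor_group_def carrier_FactGroup using coset h_closed by auto
  next
    fix U V assume "U \<in> carrier (tensor_group R M N)" "V \<in> carrier (tensor_group R M N)"
    then obtain u v where uv: "u \<in> carrier F" "v \<in> carrier F"
      and U: "U = tensor_rel R M N #>\<^bsub>F\<^esub> u" and V: "V = tensor_rel R M N #>\<^bsub>F\<^esub> v"
      unfolding tensor_group_def carrier_FactGroup by blast
    have "U \<otimes>\<^bsub>tensor_group R M N\<^esub> V = tensor_rel R M N #>\<^bsub>F\<^esub> (u + v)"
      unfolding U V using hom_mult[OF tensor_rel_coset_hom uv] by simp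
    then show "tensor_lift P \<beta> (U \<otimes>\<^bsub>tensor_group R M N\<^esub> V) =
        tensor_lift P \<beta> U \<otimes>\<^bsub>add_monoid P\<^esub> tensor_lift P \<beta> V"
      using coset[OF uv(1)] coset[OF uv(2)] coset[OF add_in_F[OF uv]] h_add[OF uv] U V by simp
  qed
qed

end

lemma balanced_comp:
  assumes "balanced R M' N' P \<beta>" "f \<in> lin_hom R M M'" "g \<in> lin_hom R N N'"
  shows "balanced R M N P (\<lambda>x y. \<beta> (f x) (g y))"
  using assms unfolding balanced_def lin_hom_def by (simp add: Pi_iff)

text \<open>Both sides are homomorphisms that agree on pure tensors. The bialgebroid axioms equate
  values of \<open>tensor_map\<close>; this turns them into equations between evaluations.\<close>

lemma tensor_lift_tensor_map:
  assumes M: "module_pair R M N" and M': "module_pair R M' N'"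
    and P: "abelian_group P" and \<beta>: "balanced R M' N' P \<beta>"
    and f: "f \<in> lin_hom R M M'" and g: "g \<in> lin_hom R N N'"
    and U: "U \<in> carrier (tensor_group R M N)"
  shows "tensor_lift P \<beta> (tensor_map R M' N' f g U) = tensor_lift P (\<lambda>x y. \<beta> (f x) (g y)) U"
proof -
  interpret M: module_pair R M N by (rule M)
  interpret M': module_pair R M' N' by (rule M')
  have closed: "f x \<in> carrier M'" "g y \<in> carrier N'" if "x \<in> carrier M" "y \<in> carrier N" for x y
    using f g that by (auto simp: lin_hom_def)
  note pure' = balanced_comp[OF M'.balanced_pure_tensor f g]
  note map = M.tensor_lift[OF M'.abelian_group_tensor pure', folded tensor_map_def]
  note lift' = M'.tensor_lift[OF P \<beta>]
  note lift = M.tensor_lift[OF P balanced_comp[OF \<beta> f g]]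
  have "tensor_lift P \<beta> \<circ> tensor_map R M' N' f g \<in> hom (tensor_group R M N) (add_monoid P)"
    using Group.hom_compose[OF map(1)[unfolded hom_add_monoid_tensor] lift'(1)] .
  then have "(tensor_lift P \<beta> \<circ> tensor_map R M' N' f g) U = tensor_lift P (\<lambda>x y. \<beta> (f x) (g y)) U"
    by (rule M.tensor_hom_eqI[OF abelian_group.a_group[OF P] _ lift(1) _ U])
       (simp add: map(2) lift'(2) lift(2) closed)
  then show ?thesis by simp
qed

section \<open>Polynomials over a field\<close>

text \<open>A nonzero combination of least degree divides every combination, because the remainder
  would be a smaller one. It is thus a common divisor of \<open>p\<close> and \<open>q\<close>, so a
  unit.\<close>

lemma field_poly_bezout:
  fixes p q :: "'k::field poly"
  assumes "coprime p q"
  shows "\<exists>u v. u * p + v * q = 1"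
proof -
  let ?J = "{u * p + v * q | u v. u * p + v * q \<noteq> 0}"
  have pq: "p \<noteq> 0 \<or> q \<noteq> 0" using assms by auto
  have "p = 1 * p + 0 * q" "q = 0 * p + 1 * q" by simp_all
  with pq have "\<exists>h. h \<in> ?J" by (metis (mono_tags, lifting) mem_Collect_eq)
  then obtain g where g: "g \<in> ?J" and least: "\<And>h. h \<in> ?J \<Longrightarrow> degree g \<le> degree h"
    by (metis (no_types, lifting) exists_least_iff[of "\<lambda>n. \<exists>h\<in>?J. degree h = n"] not_less)
  then obtain u v where uv: "g = u * p + v * q" and "g \<noteq> 0" by blast
  have div: "g dvd a * p + b * q" for a b
  proof (rule ccontr)
    assume "\<not> g dvd a * p + b * q"
    then have nz: "(a * p + b * q) mod g \<noteq> 0" by (simp add: dvd_eq_mod_eq_0)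
    let ?c = "(a * p + b * q) div g"
    have eq: "(a * p + b * q) mod g = (a - ?c * u) * p + (b - ?c * v) * q"
      unfolding minus_div_mult_eq_mod[symmetric] by (simp add: uv algebra_simps)
    with nz have "(a * p + b * q) mod g \<in> ?J" by auto
    from least[OF this] degree_mod_less[OF \<open>g \<noteq> 0\<close>, of "a * p + b * q"] nz show False by auto
  qed
  have "g dvd p" "g dvd q" using div[of 1 0] div[of 0 1] by auto
  with assms have "is_unit g" by (rule coprime_common_divisor)
  then obtain h where "1 = g * h" by (rule dvdE)
  then have "(h * u) * p + (h * v) * q = 1" by (simp add: uv algebra_simps)
  then show ?thesis by blast
qed

text \<open>Multiply the identity for \<open>p ^ n\<close> by the one for \<open>p\<close>: every
  term other than \<open>p ^ Suc n\<close> times its coefficient contains \<open>q\<close>.\<close>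

lemma comaximal_power:
  fixes p q :: "'a::comm_ring_1"
  assumes "\<exists>u v. u * p + v * q = 1"
  shows "\<exists>u v. u * p ^ n + v * q = 1"
proof (induction n)
  case 0
  have "1 * p ^ 0 + 0 * q = 1" by simp
  then show ?case by blast
next
  case (Suc n)
  then obtain u v where "u * p ^ n + v * q = 1" by blast
  moreover obtain u' v' where "u' * p + v' * q = 1" using assms by blast
  ultimately have "(u * p ^ n + v * q) * (u' * p + v' * q) = 1" by simp
  then have "(u * u') * p ^ Suc n + (u * p ^ n * v' + v * u' * p + v * q * v') * q = 1"
    by (simp add: algebra_simps)
  then show ?case by blast
qed

text \<open>In characteristic zero the derivative of a nonconstant polynomial is nonzero and has
  smaller degree.\<close>

lemma prime_elem_not_dvd_pderiv:
  fixes p :: "'k::field_char_0 poly"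
  assumes "prime_elem p"
  shows "\<not> p dvd pderiv p"
proof -
  have "degree p \<noteq> 0"
    using assms by (auto simp: prime_elem_def is_unit_iff_degree)
  then have "pderiv p \<noteq> 0" "degree (pderiv p) < degree p"
    by (auto simp: pderiv_eq_0_iff degree_pderiv)
  then show ?thesis using dvd_imp_degree_le by fastforce
qed

lemma prime_elem_not_dvd_prod:
  assumes "prime_elem p" "\<And>i. i \<in> I \<Longrightarrow> \<not> p dvd f i"
  shows "\<not> p dvd prod f I"
  using assms(2)
  by (induction I rule: infinite_finite_induct)
     (use assms(1) in \<open>auto simp: prime_elem_dvd_mult_iff dest: prime_elem_not_unit\<close>)

section \<open>Operators of finite order relative to a set of multipliers\<close>

text \<open>The Grothendieck condition for a map on a whole domain, with commutators taken only
  against \<open>S\<close>. As in \<open>diff_op_filt\<close>, index \<open>n\<close> stands for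
  order at most \<open>n - 1\<close>. It will be applied to \<open>x \<mapsto> D (f * x)\<close> on
  k[t] with \<open>S = carrier A\<close>.\<close>

primrec order_less :: "'a::idom set \<Rightarrow> nat \<Rightarrow> ('a \<Rightarrow> 'a) \<Rightarrow> bool"
  where
    "order_less S 0 P \<longleftrightarrow> (\<forall>x. P x = 0)"
  | "order_less S (Suc n) P \<longleftrightarrow> (\<forall>a\<in>S. order_less S n (\<lambda>x. P (a * x) - a * P x))"

lemma order_less_diff:
  "\<lbrakk>order_less S n P; order_less S n Q\<rbrakk> \<Longrightarrow> order_less S n (\<lambda>x. P x - Q x)"
proof (induction n arbitrary: P Q)
  case (Suc n)
  have "order_less S n (\<lambda>x. (P (a * x) - Q (a * x)) - a * (P x - Q x))" if "a \<in> S" for a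
  proof -
    have "(\<lambda>x. (P (a * x) - Q (a * x)) - a * (P x - Q x)) =
        (\<lambda>x. (P (a * x) - a * P x) - (Q (a * x) - a * Q x))"
      by (simp add: fun_eq_iff right_diff_distrib)
    then show ?thesis using Suc.IH Suc.prems that by simp
  qed
  then show ?case by simp
qed simp

text \<open>By commutativity, taking a commutator and precomposing with \<open>b\<close> can be
  interchanged.\<close>

lemma order_less_comp_mult:
  "order_less S n P \<Longrightarrow> order_less S n (\<lambda>x. P (b * x))"
proof (induction n arbitrary: P)
  case (Suc n)
  have "order_less S n (\<lambda>x. P (b * (a * x)) - a * P (b * x))" if "a \<in> S" for a
    using Suc.IH[of "\<lambda>x. P (a * x) - a * P x"] Suc.prems that
    by (simp add: mult.left_commute)
  then show ?case by simp
qed simp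

text \<open>The factor \<open>f\<close> passes through each commutator and cancels in the domain
  once index 0 is reached.\<close>

lemma order_less_mult_cancel:
  "\<lbrakk>f \<noteq> 0; order_less S n (\<lambda>x. f * P x)\<rbrakk> \<Longrightarrow> order_less S n P"
proof (induction n arbitrary: P)
  case (Suc n)
  have "order_less S n (\<lambda>x. P (a * x) - a * P x)" if "a \<in> S" for a
  proof -
    have "(\<lambda>x. f * (P (a * x) - a * P x)) = (\<lambda>x. f * P (a * x) - a * (f * P x))"
      by (simp add: fun_eq_iff right_diff_distrib mult.left_commute)
    then show ?thesis using Suc.IH[OF Suc.prems(1)] Suc.prems(2) that by simp
  qed
  then show ?case by simp
qed simp

text \<open>
  Commutators with arbitrary ring elements are controlled by \<open>f [P, b] = [P, f b] - [P, f] b\<close>.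
\<close>

lemma order_less_commutator:
  assumes "f \<noteq> 0" "\<And>b. f * b \<in> S" and P: "order_less S (Suc n) P"
  shows "order_less S n (\<lambda>x. P (b * x) - b * P x)"
proof (rule order_less_mult_cancel[OF assms(1)])
  have f: "order_less S n (\<lambda>x. P (f * x) - f * P x)"
    using P assms(2)[of 1] by simp
  have "order_less S n (\<lambda>x. P (f * b * x) - f * b * P x)"
    using P assms(2)[of b] by simp
  from order_less_diff[OF this order_less_comp_mult[OF f, of b]]
  show "order_less S n (\<lambda>x. f * (P (b * x) - b * P x))"
    by (simp add: algebra_simps)
qed

text \<open>Modulo \<open>p\<close>, the value at \<open>p * y\<close> is that of the commutator
  with \<open>p\<close> at \<open>y\<close>, so each power of \<open>p\<close> lowers the index by
  one until the operator is 0. The element \<open>p\<close> may lie outside \<open>S\<close>, hence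
  \<open>order_less_commutator\<close>.\<close>

lemma order_less_dvd_power:
  assumes "f \<noteq> 0" "\<And>b. f * b \<in> S" "order_less S n P"
  shows "p dvd P (p ^ n * x)"
  using assms(3)
proof (induction n arbitrary: P x)
  case (Suc n)
  have "p dvd P (p * (p ^ n * x)) - p * P (p ^ n * x)"
    using Suc.IH[OF order_less_commutator[OF assms(1,2) Suc.prems]] .
  then show ?case by (simp add: mult.assoc dvd_diff_left_iff)
qed simp

section \<open>Differential operators on \<open>k + f k[t]\<close>\<close>

context
  fixes f :: "'k::field poly"
begin

private abbreviation (input) "A \<equiv> const_plus_ideal f"
private abbreviation (input) "\<D> \<equiv> diff_ops (ring_of_type_algebra :: 'k ring) A"
private abbreviation (input) "filt \<equiv> diff_op_filt (ring_of_type_algebra :: 'k ring) A"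

section \<open>The algebra A = k + f k[t]\<close>

lemma const_plus_ideal_simps [simp]:
  "monoid.mult (const_plus_ideal f) = (*)" "one (const_plus_ideal f) = 1"
  "zero (const_plus_ideal f) = 0" "add (const_plus_ideal f) = (+)"
  "module.smult (const_plus_ideal f) = Polynomial.smult"
  by (simp_all add: const_plus_ideal_def)

lemma mem_const_plus_ideal: "x \<in> carrier A \<longleftrightarrow> (\<exists>c. f dvd x - [:c:])"
  by (auto simp: const_plus_ideal_def dvd_def algebra_simps)

lemma const_plus_ideal_closed:
  shows ideal_mem: "f dvd x \<Longrightarrow> x \<in> carrier A"
    and zero_mem: "0 \<in> carrier A" and one_mem: "1 \<in> carrier A"
    and add_mem: "\<lbrakk>x \<in> carrier A; y \<in> carrier A\<rbrakk> \<Longrightarrow> x + y \<in> carrier A"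
    and uminus_mem: "x \<in> carrier A \<Longrightarrow> - x \<in> carrier A"
    and mult_mem: "\<lbrakk>x \<in> carrier A; y \<in> carrier A\<rbrakk> \<Longrightarrow> x * y \<in> carrier A"
    and smult_mem: "x \<in> carrier A \<Longrightarrow> Polynomial.smult c x \<in> carrier A"
proof -
  show ideal: "x \<in> carrier A" if "f dvd x" for x
    using that by (auto simp: mem_const_plus_ideal intro!: exI[of _ 0])
  then show "0 \<in> carrier A" by simp
  show "1 \<in> carrier A"
    unfolding mem_const_plus_ideal by (rule exI[of _ 1]) (simp add: one_pCons)
  show "x + y \<in> carrier A" if "x \<in> carrier A" "y \<in> carrier A"
  proof -
    from that obtain c d where "f dvd x - [:c:]" "f dvd y - [:d:]"
      by (auto simp: mem_const_plus_ideal)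
    then have "f dvd (x - [:c:]) + (y - [:d:])" by (rule dvd_add)
    then have "f dvd (x + y) - [:c + d:]" by (simp add: algebra_simps)
    then show ?thesis by (auto simp: mem_const_plus_ideal)
  qed
  show mult: "x * y \<in> carrier A" if "x \<in> carrier A" "y \<in> carrier A" for x y
  proof -
    from that obtain c d where "f dvd x - [:c:]" "f dvd y - [:d:]"
      by (auto simp: mem_const_plus_ideal)
    then have "f dvd (x - [:c:]) * y + [:c:] * (y - [:d:])" by (intro dvd_add dvd_mult dvd_mult2)
    then have "f dvd x * y - [:c * d:]" by (simp add: algebra_simps)
    then show ?thesis by (auto simp: mem_const_plus_ideal)
  qed
  have const: "[:c:] \<in> carrier A" for c
    unfolding mem_const_plus_ideal by (rule exI[of _ c]) simp
  show "Polynomial.smult c x \<in> carrier A" if "x \<in> carrier A" for c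
    using mult[OF const[of c] that] by simp
  then show "- x \<in> carrier A" if "x \<in> carrier A"
    using mult[OF const[of "-1"] that] by simp
qed

lemma abelian_group_const_plus_ideal: "abelian_group A"
  by (rule abelian_groupI)
     (auto simp: const_plus_ideal_closed add.assoc add.commute intro!: bexI[where x = "- _"])

lemma minus_const_plus_ideal [simp]:
  assumes "x \<in> carrier A" "y \<in> carrier A"
  shows "x \<ominus>\<^bsub>A\<^esub> y = x - y"
proof -
  have "\<ominus>\<^bsub>A\<^esub> y = - y"
    using abelian_group.minus_equality[OF abelian_group_const_plus_ideal, of "- y" y] assms
    by (simp add: uminus_mem)
  then show ?thesis by (simp add: a_minus_def)
qed

section \<open>The order filtration and its closure properties\<close>

lemma filt_closed: "\<lbrakk>D \<in> filt n; x \<in> carrier A\<rbrakk> \<Longrightarrow> D x \<in> carrier A"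
  by (cases n) (auto simp: endos_def lin_hom_def zero_mem)

lemma filt_add:
  "\<lbrakk>D \<in> filt n; x \<in> carrier A; y \<in> carrier A\<rbrakk> \<Longrightarrow> D (x + y) = D x + D y"
  by (cases n) (auto simp: endos_def lin_hom_def add_mem)

lemma commutator_eq:
  assumes "D \<in> carrier A \<rightarrow> carrier A" "a \<in> carrier A"
  shows "commutator A D a = (\<lambda>b\<in>carrier A. D (a * b) - a * D b)"
  unfolding commutator_def const_plus_ideal_simps using assms
  by (intro restrict_ext minus_const_plus_ideal) (auto intro: mult_mem)

lemma filt_funcset: "D \<in> filt n \<Longrightarrow> D \<in> carrier A \<rightarrow> carrier A"
  using filt_closed by blast

lemma mem_endos:
  "D \<in> endos (ring_of_type_algebra :: 'k ring) A \<longleftrightarrow>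
    D \<in> carrier A \<rightarrow> carrier A \<and> D \<in> extensional (carrier A) \<and>
    (\<forall>x\<in>carrier A. \<forall>y\<in>carrier A. D (x + y) = D x + D y) \<and>
    (\<forall>c. \<forall>x\<in>carrier A. D (Polynomial.smult c x) = Polynomial.smult c (D x))"
  by (auto simp: endos_def lin_hom_def ring_of_type_algebra_def)

lemma restrict_mem_endos:
  assumes "\<And>x. x \<in> carrier A \<Longrightarrow> D x \<in> carrier A"
    and "\<And>x y. \<lbrakk>x \<in> carrier A; y \<in> carrier A\<rbrakk> \<Longrightarrow> D (x + y) = D x + D y"
    and "\<And>c x. x \<in> carrier A \<Longrightarrow> D (Polynomial.smult c x) = Polynomial.smult c (D x)"
  shows "(\<lambda>x\<in>carrier A. D x) \<in> endos (ring_of_type_algebra :: 'k ring) A"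
  unfolding mem_endos using assms by (simp add: add_mem smult_mem)

lemma filt_SucI:
  assumes "D \<in> endos (ring_of_type_algebra :: 'k ring) A"
    and "\<And>a. a \<in> carrier A \<Longrightarrow> commutator A D a \<in> filt n"
  shows "D \<in> filt (Suc n)"
  using assms by simp

lemma filt_SucD:
  assumes "D \<in> filt (Suc n)"
  shows "D \<in> endos (ring_of_type_algebra :: 'k ring) A"
    and "\<And>a. a \<in> carrier A \<Longrightarrow> commutator A D a \<in> filt n"
  using assms by simp_all

lemma zero_filt: "(\<lambda>b\<in>carrier A. 0) \<in> filt n"
proof (induction n)
  case 0
  show ?case by (simp only: diff_op_filt.simps const_plus_ideal_simps singleton_iff)
next
  case (Suc n)
  have "commutator A (\<lambda>b\<in>carrier A. 0) a = (\<lambda>b\<in>carrier A. 0)" if "a \<in> carrier A" for a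
    using that by (subst commutator_eq) (auto intro!: restrict_ext simp: mult_mem zero_mem)
  with Suc show ?case
    by (intro filt_SucI restrict_mem_endos) (simp_all only: zero_mem, simp_all)
qed

lemma filt_Suc: "D \<in> filt n \<Longrightarrow> D \<in> filt (Suc n)"
proof (induction n arbitrary: D)
  case 0
  then have "D = (\<lambda>b\<in>carrier A. 0)" by simp
  then show ?case using zero_filt[of "Suc 0"] by (simp only:)
next
  case (Suc n)
  then show ?case by (blast intro: filt_SucI dest: filt_SucD)
qed

lemma filt_mono: "\<lbrakk>n \<le> m; D \<in> filt n\<rbrakk> \<Longrightarrow> D \<in> filt m"
  by (induction m rule: dec_induct) (auto simp del: diff_op_filt.simps intro: filt_Suc)

lemma filt_plus:
  "\<lbrakk>D \<in> filt n; E \<in> filt n\<rbrakk> \<Longrightarrow> (\<lambda>b\<in>carrier A. D b + E b) \<in> filt n"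
proof (induction n arbitrary: D E)
  case 0
  then show ?case by (auto intro!: restrict_ext)
next
  case (Suc n)
  note D = Suc.prems(1) and E = Suc.prems(2)
  show ?case
  proof (rule filt_SucI)
    show endo: "(\<lambda>b\<in>carrier A. D b + E b) \<in> endos (ring_of_type_algebra :: 'k ring) A"
      using D[THEN filt_SucD(1)] E[THEN filt_SucD(1)]
      by (intro restrict_mem_endos) (auto simp: mem_endos filt_closed[OF D] filt_closed[OF E] add_mem smult_add_right
          simp del: diff_op_filt.simps)
    fix a assume a: "a \<in> carrier A"
    have "commutator A (\<lambda>b\<in>carrier A. D b + E b) a =
        (\<lambda>b\<in>carrier A. commutator A D a b + commutator A E a b)"
      unfolding commutator_eq[OF filt_funcset[OF D] a] commutator_eq[OF filt_funcset[OF E] a]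
        commutator_eq[OF endo[THEN mem_endos[THEN iffD1], THEN conjunct1] a]
      using a by (intro restrict_ext) (simp add: mult_mem algebra_simps)
    with Suc.IH[OF D[THEN filt_SucD(2)] E[THEN filt_SucD(2)], OF a a]
    show "commutator A (\<lambda>b\<in>carrier A. D b + E b) a \<in> filt n" by (simp only:)
  qed
qed

lemma filt_mult_left:
  "\<lbrakk>D \<in> filt n; c \<in> carrier A\<rbrakk> \<Longrightarrow> (\<lambda>b\<in>carrier A. c * D b) \<in> filt n"
proof (induction n arbitrary: D)
  case 0
  then show ?case by (auto intro!: restrict_ext)
next
  case (Suc n)
  note D = Suc.prems(1) and c = Suc.prems(2)
  show ?case
  proof (rule filt_SucI)
    show endo: "(\<lambda>b\<in>carrier A. c * D b) \<in> endos (ring_of_type_algebra :: 'k ring) A"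
      using D[THEN filt_SucD(1)] c
      by (intro restrict_mem_endos) (auto simp: mem_endos filt_closed[OF D] mult_mem distrib_left
          simp del: diff_op_filt.simps)
    fix a assume a: "a \<in> carrier A"
    have "commutator A (\<lambda>b\<in>carrier A. c * D b) a = (\<lambda>b\<in>carrier A. c * commutator A D a b)"
      unfolding commutator_eq[OF filt_funcset[OF D] a]
        commutator_eq[OF endo[THEN mem_endos[THEN iffD1], THEN conjunct1] a]
      using a c by (intro restrict_ext) (simp add: mult_mem right_diff_distrib mult.left_commute)
    with Suc.IH[OF D[THEN filt_SucD(2)] c, OF a]
    show "commutator A (\<lambda>b\<in>carrier A. c * D b) a \<in> filt n" by (simp only:)
  qed
qed

text \<open>This is the product of \<open>D\<close> with the multiplication operator
  \<open>c\<close>, the operation compared in the Takeuchi condition. By commutativity it can be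
  interchanged with commutators.\<close>

lemma filt_mult_right:
  "\<lbrakk>D \<in> filt n; c \<in> carrier A\<rbrakk> \<Longrightarrow> (\<lambda>b\<in>carrier A. D (c * b)) \<in> filt n"
proof (induction n arbitrary: D)
  case 0
  then show ?case by (auto intro!: restrict_ext simp: mult_mem)
next
  case (Suc n)
  note D = Suc.prems(1) and c = Suc.prems(2)
  show ?case
  proof (rule filt_SucI)
    show endo: "(\<lambda>b\<in>carrier A. D (c * b)) \<in> endos (ring_of_type_algebra :: 'k ring) A"
      using D[THEN filt_SucD(1)] c
      by (intro restrict_mem_endos) (auto simp: mem_endos filt_closed[OF D] mult_mem distrib_left
          simp del: diff_op_filt.simps)
    fix a assume a: "a \<in> carrier A"
    have "commutator A (\<lambda>b\<in>carrier A. D (c * b)) a = (\<lambda>b\<in>carrier A. commutator A D a (c * b))"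
      unfolding commutator_eq[OF filt_funcset[OF D] a]
        commutator_eq[OF endo[THEN mem_endos[THEN iffD1], THEN conjunct1] a]
      using a c by (intro restrict_ext) (simp add: mult_mem mult.left_commute)
    with Suc.IH[OF D[THEN filt_SucD(2)] c, OF a]
    show "commutator A (\<lambda>b\<in>carrier A. D (c * b)) a \<in> filt n" by (simp only:)
  qed
qed

text \<open>The union in \<open>diff_ops\<close> starts at index 1; \<open>filt_Suc\<close> absorbs
  index 0.\<close>

lemma mem_diff_ops: "D \<in> carrier \<D> \<longleftrightarrow> (\<exists>n. D \<in> filt n)"
  unfolding diff_ops_def using filt_Suc by (auto simp del: diff_op_filt.simps)

lemma diff_ops_simps [simp]:
  "monoid.mult \<D> D E = (\<lambda>b\<in>carrier A. D (E b))"
  "add \<D> D E = (\<lambda>b\<in>carrier A. D b + E b)"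
  "module.smult \<D> a D = (\<lambda>b\<in>carrier A. a * D b)"
  "one \<D> = (\<lambda>b\<in>carrier A. b)"
  by (simp_all add: diff_ops_def)

lemma diff_ops_closed: "\<lbrakk>D \<in> carrier \<D>; x \<in> carrier A\<rbrakk> \<Longrightarrow> D x \<in> carrier A"
  by (auto simp: mem_diff_ops filt_closed)

lemma diff_ops_plus:
  assumes "D \<in> carrier \<D>" "E \<in> carrier \<D>"
  shows "(\<lambda>b\<in>carrier A. D b + E b) \<in> carrier \<D>"
proof -
  from assms obtain m n where "D \<in> filt m" "E \<in> filt n" by (auto simp: mem_diff_ops)
  then have "D \<in> filt (max m n)" "E \<in> filt (max m n)" by (auto intro: filt_mono[rotated])
  from filt_plus[OF this] show ?thesis by (auto simp: mem_diff_ops)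
qed

lemma diff_ops_mult_left:
  "\<lbrakk>D \<in> carrier \<D>; c \<in> carrier A\<rbrakk> \<Longrightarrow> (\<lambda>b\<in>carrier A. c * D b) \<in> carrier \<D>"
  using filt_mult_left by (auto simp: mem_diff_ops)

lemma diff_ops_mult_right:
  "\<lbrakk>D \<in> carrier \<D>; c \<in> carrier A\<rbrakk> \<Longrightarrow> (\<lambda>b\<in>carrier A. D (c * b)) \<in> carrier \<D>"
  using filt_mult_right by (auto simp: mem_diff_ops)

section \<open>Explicit operators of order at most two\<close>

text \<open>Derivatives may leave A, but the factor \<open>f\<close> in \<open>p\<close> and
  \<open>q\<close> brings the values back. The second-order terms cancel in the commutator with
  \<open>a\<close>, which leaves coefficients still divisible by \<open>f\<close>; one formula thus
  serves orders 0, 1 and 2.\<close>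

lemma second_order_filt_Suc:
  assumes p: "f dvd p" and q: "f dvd q" and s: "s \<in> carrier A"
    and commutators: "\<And>a. a \<in> carrier A \<Longrightarrow>
      (\<lambda>x\<in>carrier A. (2 * p * pderiv a) * pderiv x + (p * pderiv (pderiv a) + q * pderiv a) * x) \<in> filt n"
  shows "(\<lambda>x\<in>carrier A. p * pderiv (pderiv x) + q * pderiv x + s * x) \<in> filt (Suc n)"
proof (rule filt_SucI)
  have closed: "p * pderiv (pderiv x) + q * pderiv x + s * x \<in> carrier A" if "x \<in> carrier A" for x
    using p q s that by (intro add_mem mult_mem[of s]) (auto intro: ideal_mem)
  then show endo: "(\<lambda>x\<in>carrier A. p * pderiv (pderiv x) + q * pderiv x + s * x)
      \<in> endos (ring_of_type_algebra :: 'k ring) A"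
    by (rule restrict_mem_endos)
       (simp_all add: pderiv_add pderiv_smult distrib_left smult_add_right)
  fix a assume a: "a \<in> carrier A"
  have "commutator A (\<lambda>x\<in>carrier A. p * pderiv (pderiv x) + q * pderiv x + s * x) a =
    (\<lambda>x\<in>carrier A. (2 * p * pderiv a) * pderiv x + (p * pderiv (pderiv a) + q * pderiv a) * x)"
    unfolding commutator_eq[OF endo[THEN mem_endos[THEN iffD1], THEN conjunct1] a]
    using a by (intro restrict_ext) (simp add: mult_mem pderiv_mult pderiv_add algebra_simps)
  then show "commutator A (\<lambda>x\<in>carrier A. p * pderiv (pderiv x) + q * pderiv x + s * x) a \<in> filt n"
    using commutators[OF a] by (simp only:)
qed

lemma second_order_mem_diff_ops:
  assumes "f dvd p"
  shows "(\<lambda>x\<in>carrier A. p * pderiv (pderiv x)) \<in> carrier \<D>"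
proof -
  \<comment> \<open>Climbing the orders: with \<open>p = q = 0\<close> the commutators vanish, with
    \<open>p = 0\<close> they are multiplications, and in general they are first-order operators as
    in \<open>1\<close>.\<close>
  have 0: "(\<lambda>x\<in>carrier A. s * x) \<in> filt (Suc 0)" if "s \<in> carrier A" for s
    using second_order_filt_Suc[of 0 0 s 0] that by simp
  have 1: "(\<lambda>x\<in>carrier A. q * pderiv x + s * x) \<in> filt (Suc (Suc 0))"
    if "f dvd q" "s \<in> carrier A" for q s
    using second_order_filt_Suc[of 0 q s "Suc 0"] 0 that
    by (simp del: diff_op_filt.simps add: ideal_mem)
  have "(\<lambda>x\<in>carrier A. p * pderiv (pderiv x)) \<in> filt (Suc (Suc (Suc 0)))"
    using second_order_filt_Suc[of p 0 0 "Suc (Suc 0)"] 1 assms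
    by (simp del: diff_op_filt.simps add: ideal_mem zero_mem)
  then show ?thesis
    unfolding mem_diff_ops by blast
qed

section \<open>Operators preserve the ideal f k[t]\<close>

text \<open>Since \<open>f * x\<close> lies in A for every polynomial \<open>x\<close>, this extends
  the domain from A to k[t], so that arbitrary polynomials can act as multipliers.\<close>

lemma filt_order_less:
  "D \<in> filt n \<Longrightarrow> order_less (carrier A) n (\<lambda>x. D (f * x))"
proof (induction n arbitrary: D)
  case 0
  then show ?case by (simp add: ideal_mem)
next
  case (Suc n)
  have "order_less (carrier A) n (\<lambda>x. D (f * (a * x)) - a * D (f * x))" if a: "a \<in> carrier A" for a
  proof -
    from Suc.IH[OF filt_SucD(2)[OF Suc.prems a]] show ?thesis
      unfolding commutator_eq[OF filt_funcset[OF Suc.prems] a]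
      by (simp add: ideal_mem mult.left_commute)
  qed
  then show ?case by simp
qed

text \<open>
  Here the reducibility of \<open>f\<close> enters: modulo \<open>f\<close> the values of \<open>x \<mapsto> D (f x)\<close> are constants, which
  vanish on a power of \<open>(p)\<close> and on a power of \<open>(q)\<close>, and these powers are comaximal.
\<close>

lemma diff_ops_preserve_ideal:
  assumes D: "D \<in> carrier \<D>" and f: "f \<noteq> 0"
    and p: "p dvd f" "\<not> is_unit p" and q: "q dvd f" "\<not> is_unit q" and pq: "coprime p q"
  shows "f dvd D (f * x)"
proof -
  from D obtain n where n: "D \<in> filt n" by (auto simp: mem_diff_ops)
  have ord: "order_less (carrier A) n (\<lambda>x. D (f * x))" by (rule filt_order_less[OF n])
  have dvd: "f dvd D (f * (r ^ n * x))" if r: "r dvd f" "\<not> is_unit r" for r x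
  proof -
    have "r dvd D (f * (r ^ n * x))"
      by (rule order_less_dvd_power[OF f _ ord]) (simp add: ideal_mem)
    moreover obtain c where c: "f dvd D (f * (r ^ n * x)) - [:c:]"
      using filt_closed[OF n ideal_mem] unfolding mem_const_plus_ideal by (meson dvd_triv_left)
    ultimately have "r dvd [:c:]"
      using dvd_trans[OF r(1) c] by (metis dvd_diff_right_iff)
    \<comment> \<open>A nonzero constant is a unit and has no nonunit divisor
      \<open>r\<close>.\<close>
    then have "c = 0" using r(2) by (metis dvd_trans is_unit_triv)
    then show ?thesis using c by simp
  qed
  \<comment> \<open>The power is raised on one side at a time: first \<open>p\<close>, then, with
    the roles swapped, \<open>q\<close>.\<close>
  have "\<exists>u v. u * p ^ n + v * q = 1"
    by (rule comaximal_power[OF field_poly_bezout[OF pq]])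
  then have "\<exists>v u. v * q + u * p ^ n = 1" by (metis add.commute)
  then obtain v u where "v * q ^ n + u * p ^ n = 1"
    using comaximal_power by blast
  then have "f * x = f * (v * q ^ n + u * p ^ n) * x" by simp
  also have "\<dots> = f * (q ^ n * (v * x)) + f * (p ^ n * (u * x))"
    by (simp add: algebra_simps)
  finally have "D (f * x) = D (f * (q ^ n * (v * x))) + D (f * (p ^ n * (u * x)))"
    using filt_add[OF n] by (simp add: ideal_mem)
  then show ?thesis using dvd[OF p] dvd[OF q] by simp
qed

section \<open>Evaluating tensors of operators\<close>

text \<open>The tensors whose value is divisible by \<open>g\<close> form a subgroup, so pure
  tensors suffice. Divisibility is meant in k[t], not in A.\<close>

lemma tensor_lift_dvd:
  assumes M: "module_pair A M N" and \<beta>: "balanced A M N A \<beta>"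
    and dvd: "\<And>x y. \<lbrakk>x \<in> carrier M; y \<in> carrier N\<rbrakk> \<Longrightarrow> g dvd \<beta> x y"
    and U: "U \<in> carrier (tensor_group A M N)"
  shows "g dvd tensor_lift A \<beta> U"
proof -
  interpret module_pair A M N by (rule M)
  interpret T: comm_group "tensor_group A M N" by (rule comm_group_tensor)
  note lift = tensor_lift[OF abelian_group_const_plus_ideal \<beta>]
  interpret h: group_hom "tensor_group A M N" "add_monoid A" "tensor_lift A \<beta>"
    by (rule group_hom.intro[OF T.is_group abelian_group.a_group[OF abelian_group_const_plus_ideal]])
       (rule group_hom_axioms.intro[OF lift(1)])
  have mult: "tensor_lift A \<beta> (V \<otimes>\<^bsub>tensor_group A M N\<^esub> W) = tensor_lift A \<beta> V + tensor_lift A \<beta> W"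
    if "V \<in> carrier (tensor_group A M N)" "W \<in> carrier (tensor_group A M N)" for V W
    using h.hom_mult[OF that] by simp
  have inv: "tensor_lift A \<beta> (inv\<^bsub>tensor_group A M N\<^esub> V) = - tensor_lift A \<beta> V"
    if "V \<in> carrier (tensor_group A M N)" for V
    using mult[OF T.inv_closed[OF that] that] h.hom_one T.l_inv[OF that]
    by (simp add: eq_neg_iff_add_eq_0)
  have "subgroup {V \<in> carrier (tensor_group A M N). g dvd tensor_lift A \<beta> V} (tensor_group A M N)"
    by (rule T.subgroupI) (use h.hom_one in \<open>auto simp: mult inv simp del: h.hom_inv\<close>)
  from subgroup_pure_tensors_carrier[OF this] show ?thesis
    using U pure_tensor_closed lift(2) dvd by auto
qed

lemma module_pair_diff_ops: "module_pair A \<D> \<D>"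
  by unfold_locales (simp_all add: diff_ops_plus diff_ops_mult_left)

lemma module_pair_regular_diff_ops: "module_pair A (regular_module A) \<D>"
  by unfold_locales
     (simp_all add: regular_module_def add_mem mult_mem diff_ops_plus diff_ops_mult_left)

text \<open>A scalar on either operator multiplies its value, hence the same product
  \<open>D a * E b\<close>.\<close>

lemma balanced_evaluation:
  assumes "a \<in> carrier A" "b \<in> carrier A"
  shows "balanced A \<D> \<D> A (\<lambda>D E. D a * E b)"
  unfolding balanced_def using assms
  by (simp add: diff_ops_closed mult_mem distrib_left distrib_right mult.left_commute mult.assoc)

text \<open>The counterpart on the tensor product of A and the operators, where the left counit law
  takes its values.\<close>

lemma balanced_regular_evaluation:
  assumes "b \<in> carrier A"
  shows "balanced A (regular_module A) \<D> A (\<lambda>x E. x * E b)"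
  unfolding balanced_def regular_module_def using assms
  by (simp add: diff_ops_closed mult_mem distrib_left distrib_right mult.left_commute mult.assoc)

lemma right_mult_base_incl:
  assumes "a \<in> carrier A"
  shows "D \<otimes>\<^bsub>\<D>\<^esub> base_incl \<D> a = (\<lambda>b\<in>carrier A. D (a * b))"
  unfolding base_incl_def by (simp cong: restrict_cong)

lemma right_mult_base_incl_lin_hom:
  assumes "a \<in> carrier A"
  shows "(\<lambda>D. D \<otimes>\<^bsub>\<D>\<^esub> base_incl \<D> a) \<in> lin_hom A \<D> \<D>"
  unfolding right_mult_base_incl[OF assms] lin_hom_def using assms
  by (auto simp: diff_ops_mult_right mult_mem intro!: restrict_ext)

text \<open>
  Evaluating \<open>D\<^sub>(\<^sub>1\<^sub>) a \<otimes> D\<^sub>(\<^sub>2\<^sub>) = D\<^sub>(\<^sub>1\<^sub>) \<otimes> D\<^sub>(\<^sub>2\<^sub>) a\<close> at \<open>(1, b)\<close> turns the Takeuchi condition and the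
  left counit law into the Leibniz rule \<open>D (a b) = D\<^sub>(\<^sub>1\<^sub>) a D\<^sub>(\<^sub>2\<^sub>) b\<close>.
\<close>

lemma bialgebroid_leibniz:
  assumes str: "bialgebroid_structure A \<D> \<Delta> (\<lambda>D. D \<one>\<^bsub>A\<^esub>)"
    and D: "D \<in> carrier \<D>" and a: "a \<in> carrier A" and b: "b \<in> carrier A"
  shows "\<Delta> D \<in> carrier (tensor_group A \<D> \<D>)"
    and "tensor_lift A (\<lambda>D E. D a * E b) (\<Delta> D) = D (a * b)"
proof -
  have \<epsilon>: "(\<lambda>D. D 1) \<in> lin_hom A \<D> (regular_module A)"
    and counit: "tensor_map A (regular_module A) \<D> (\<lambda>D. D 1) (\<lambda>E. E) (\<Delta> D) =
         pure_tensor A (regular_module A) \<D> 1 D"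
    and \<Delta>: "\<Delta> \<in> ring_hom \<D> (takeuchi A \<D>)"
    using str D unfolding bialgebroid_structure_def by simp_all
  have "\<Delta> D \<in> carrier (takeuchi A \<D>)"
    by (rule ring_hom_closed[OF \<Delta> D])
  then have U: "\<Delta> D \<in> carrier (tensor_group A \<D> \<D>)"
    and takeuchi: "tensor_map A \<D> \<D> (\<lambda>D. D \<otimes>\<^bsub>\<D>\<^esub> base_incl \<D> a) (\<lambda>E. E) (\<Delta> D) =
        tensor_map A \<D> \<D> (\<lambda>D. D) (\<lambda>E. E \<otimes>\<^bsub>\<D>\<^esub> base_incl \<D> a) (\<Delta> D)"
    using a unfolding takeuchi_def by simp_all
  show "\<Delta> D \<in> carrier (tensor_group A \<D> \<D>)" by (rule U)
  have id: "(\<lambda>E. E) \<in> lin_hom A \<D> \<D>" by (simp add: lin_hom_def)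
  have ab: "a * b \<in> carrier A" by (rule mult_mem[OF a b])
  note abg = abelian_group_const_plus_ideal
  note lift_map = tensor_lift_tensor_map[OF module_pair_diff_ops module_pair_diff_ops abg
      balanced_evaluation[OF one_mem b] _ _ U]
  \<comment> \<open>\<open>D a\<close> is the value at 1 of the product of \<open>D\<close> with the
    multiplication operator \<open>a\<close>; the Takeuchi condition then moves \<open>a\<close> to
    the second factor.\<close>
  have "tensor_lift A (\<lambda>D E. D a * E b) (\<Delta> D) = tensor_lift A (\<lambda>D E. D 1 * E b)
      (tensor_map A \<D> \<D> (\<lambda>D. D \<otimes>\<^bsub>\<D>\<^esub> base_incl \<D> a) (\<lambda>E. E) (\<Delta> D))"
    using a b one_mem
    by (subst lift_map[OF right_mult_base_incl_lin_hom[OF a] id]) (simp add: right_mult_base_incl[OF a] del: diff_ops_simps)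
  also have "\<dots> = tensor_lift A (\<lambda>D E. D 1 * E (a * b)) (\<Delta> D)"
    unfolding takeuchi using a b one_mem
    by (subst lift_map[OF id right_mult_base_incl_lin_hom[OF a]]) (simp add: right_mult_base_incl[OF a] del: diff_ops_simps)
  \<comment> \<open>Now \<open>D 1\<close> is the counit, and the counit law replaces the tensor by
    the pure tensor of 1 and \<open>D\<close>.\<close>
  also have "\<dots> = tensor_lift A (\<lambda>x E. x * E (a * b)) (pure_tensor A (regular_module A) \<D> 1 D)"
    unfolding counit[symmetric]
    by (rule tensor_lift_tensor_map[OF module_pair_diff_ops module_pair_regular_diff_ops abg
        balanced_regular_evaluation[OF ab] \<epsilon> id U, symmetric])
  also have "\<dots> = D (a * b)"
    using D one_mem module_pair.tensor_lift_pure[OF module_pair_regular_diff_ops abg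
        balanced_regular_evaluation[OF ab], of 1 D]
    by (simp add: regular_module_def)
  finally show "tensor_lift A (\<lambda>D E. D a * E b) (\<Delta> D) = D (a * b)" .
qed

end

section \<open>The contradiction at f squared\<close>

theorem theorem4p2:
  fixes fs :: "nat \<Rightarrow> 'k::field_char_0 poly" and r :: nat
  assumes "r \<ge> 2"
    and "\<And>i. i \<in> {1..r} \<Longrightarrow> irreducible (fs i)"
    and "\<And>i j. i \<in> {1..r} \<Longrightarrow> j \<in> {1..r} \<Longrightarrow> i \<noteq> j \<Longrightarrow> coprime (fs i) (fs j)"
  defines "A \<equiv> const_plus_ideal (\<Prod>i\<in>{1..r}. fs i)"
  defines "\<D> \<equiv> diff_ops (ring_of_type_algebra :: 'k ring) A"
  shows "\<not> (\<exists>\<Delta>. bialgebroid_structure A \<D> \<Delta> (\<lambda>D. D \<one>\<^bsub>A\<^esub>))"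
proof
  assume "\<exists>\<Delta>. bialgebroid_structure A \<D> \<Delta> (\<lambda>D. D \<one>\<^bsub>A\<^esub>)"
  then obtain \<Delta> where str: "bialgebroid_structure A \<D> \<Delta> (\<lambda>D. D \<one>\<^bsub>A\<^esub>)" by blast
  define f where "f = (\<Prod>i\<in>{1..r}. fs i)"
  note str = str[unfolded A_def \<D>_def, folded f_def]
  define p where "p = fs 1"
  define q where "q = fs 2"
  define g where "g = (\<Prod>i\<in>{1..r} - {1}. fs i)"
  have r: "1 \<in> {1..r}" "2 \<in> {1..r}" using assms(1) by auto
  have fg: "f = p * g" unfolding f_def g_def p_def by (rule prod.remove) (use r in auto)
  have p: "p dvd f" "\<not> is_unit p" and q: "q dvd f" "\<not> is_unit q" and pq: "coprime p q"
    unfolding p_def q_def f_def using r assms(2,3)[of 1] assms(2)[of 2] assms(3)[of 1 2]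
    by (auto intro!: dvd_prodI simp: irreducible_def)
  have prime: "prime_elem p"
    unfolding p_def by (rule field_poly_irreducible_imp_prime) (use assms(2) r in blast)
  have f0: "f \<noteq> 0"
    unfolding f_def using assms(2) by (auto simp: irreducible_def)
  \<comment> \<open>Otherwise \<open>p\<close> would be a common divisor of two coprime factors,
    hence a unit.\<close>
  have "\<not> p dvd fs i" if "i \<in> {1..r} - {1}" for i
    using that r p(2) assms(3)[of 1 i] coprime_common_divisor[of p "fs i" p] unfolding p_def by auto
  then have g: "\<not> p dvd g"
    unfolding g_def by (rule prime_elem_not_dvd_prod[OF prime])
  let ?A = "const_plus_ideal f" and ?D = "diff_ops (ring_of_type_algebra :: 'k ring) (const_plus_ideal f)"
  \<comment> \<open>The leading factor \<open>f\<close> makes this an operator on A, yet supplies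
    only one of the two factors \<open>f\<close> that the value at \<open>f * f\<close> would
    need.\<close>
  define D where "D = (\<lambda>x\<in>carrier ?A. f * pderiv (pderiv x))"
  have D: "D \<in> carrier ?D"
    unfolding D_def by (rule second_order_mem_diff_ops) simp
  have f: "f \<in> carrier ?A" by (simp add: ideal_mem)
  note leibniz = bialgebroid_leibniz[OF str D f f]
  \<comment> \<open>Each of the two operators in a pure tensor sends \<open>f = f * 1\<close> into
    the ideal.\<close>
  have "f * f dvd tensor_lift ?A (\<lambda>D E. D f * E f) (\<Delta> D)"
  proof (rule tensor_lift_dvd[OF module_pair_diff_ops balanced_evaluation[OF f f] _ leibniz(1)])
    fix E E' assume "E \<in> carrier ?D" "E' \<in> carrier ?D"
    then show "f * f dvd E f * E' f"
      using diff_ops_preserve_ideal[OF _ f0 p q pq, of _ 1] by (simp add: mult_dvd_mono)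
  qed
  then have "f * f dvd f * pderiv (pderiv (f * f))"
    unfolding leibniz(2) by (simp add: D_def ideal_mem)
  \<comment> \<open>One factor \<open>f\<close> cancels, and by the Leibniz rule the second
    derivative of \<open>f * f\<close> is twice the square of \<open>pderiv f\<close> modulo
    \<open>f\<close>.\<close>
  then have "f dvd 2 * (pderiv f * pderiv f) + f * (2 * pderiv (pderiv f))"
  proof -
    have "pderiv (pderiv (f * f)) = 2 * (pderiv f * pderiv f) + f * (2 * pderiv (pderiv f))"
      by (simp add: pderiv_mult pderiv_add algebra_simps)
    with \<open>f * f dvd f * pderiv (pderiv (f * f))\<close> f0 show ?thesis by simp
  qed
  then have "f dvd 2 * (pderiv f * pderiv f)"
    by (simp add: dvd_add_left_iff)
  then have "p dvd 2 * (pderiv f * pderiv f)"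
    by (rule dvd_trans[OF p(1)])
  then have "p dvd smult 2 (pderiv f * pderiv f)"
    by (simp add: numeral_mult_conv_smult)
  \<comment> \<open>Characteristic zero makes the scalar 2 invertible.\<close>
  then have "p dvd pderiv f * pderiv f"
    by (simp add: dvd_smult_iff)
  then have "p dvd pderiv f"
    using prime by (simp add: prime_elem_dvd_mult_iff)
  \<comment> \<open>Modulo \<open>p\<close>, the derivative of \<open>p * g\<close> is
    \<open>pderiv p * g\<close>; primality contradicts that \<open>p\<close> divides neither
    factor.\<close>
  then have "p dvd pderiv p * g"
    unfolding fg by (simp add: pderiv_mult mult.commute dvd_add_left_iff)
  then show False
    using prime g prime_elem_not_dvd_pderiv[OF prime] by (simp add: prime_elem_dvd_mult_iff)
qed

end
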